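(* Let $U\subset\mathbb{R}^2$ be a convex set with nonempty interior, let $t_0<t_1$, $s_0<s_1$, $x_0,x_1$ be real numbers, and let $f\in C^2(\mathbb{R}^3\to\mathbb{R})$. Let $\hat x$ be an optimal solution of the problem $$I(x)=\int_{t_0}^{t_1}f(t,x,\dot x)\,dt\to\min,$$ where $x$ ranges over convex functions on $[t_0;t_1]$ with $(t,x(t))\in U$ for all $t\in[t_0;t_1]$, $x(t_0)=x_0$, $x(t_1)=x_1$, $\dot x(t_0+0)\ge s_0$, $\dot x(t_1-0)\le s_1$. Suppose that $(t,\hat x(t))\in\operatorname{int}U$ for all $t\in(t_0,t_1)$, and that $f_{\dot x\dot x}(t,x,\dot x)>0$ at all points of $$\Gamma=\{(t,x,\dot x): t\in[t_0,t_1],\ x=\hat x(t),\ \dot x\in\partial\hat x(t)\}\subset\mathbb{R}^3.$$ Then $\hat x\in C^1[t_0;t_1]$.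
   Context: $\partial\hat x(t)$ denotes the subdifferential of the convex function $\hat x$ at $t$; $\dot x(t\pm0)$ are the one-sided limits of the derivative.
   Formalization: The convex functions on [t0;t1], including the optimal solution, are also required to be continuous on [t0;t1]; otherwise upward jumps at the endpoints are allowed and an optimal solution can be discontinuous (f = x²+ẋ², x0 = x1 = 1, x̂ = 0 on (0;1)). *)

theory Defs
  imports "HOL-Analysis.Analysis"
begin

text \<open>Twice continuously Frechet differentiable on the whole space.\<close>

definition C2_function :: "('a::real_normed_vector \<Rightarrow> 'b::real_normed_vector) \<Rightarrow> bool" where
  "C2_function f \<longleftrightarrow>
     (\<exists>(f' :: 'a \<Rightarrow> 'a \<Rightarrow>\<^sub>L 'b) (f'' :: 'a \<Rightarrow> 'a \<Rightarrow>\<^sub>L ('a \<Rightarrow>\<^sub>L 'b)).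
        (\<forall>p. (f has_derivative blinfun_apply (f' p)) (at p)) \<and>
        (\<forall>p. (f' has_derivative blinfun_apply (f'' p)) (at p)) \<and>
        continuous_on UNIV f'')"

text \<open>\<open>C\<^sup>1[a;b]\<close>; the derivatives at \<open>a\<close> and \<open>b\<close> are one-sided, so that values outside
  \<open>[a;b]\<close> are irrelevant (unlike in \<^const>\<open>C1_differentiable_on\<close>).\<close>

definition C1_on_interval :: "real \<Rightarrow> real \<Rightarrow> (real \<Rightarrow> real) \<Rightarrow> bool" where
  "C1_on_interval a b x \<longleftrightarrow>
     (\<exists>x'. (\<forall>t\<in>{a..b}. (x has_real_derivative x' t) (at t within {a..b})) \<and>
           continuous_on {a..b} x')"

text \<open>\<open>\<partial>\<^sup>2 f / \<partial>v\<^sup>2\<close> at the point \<open>(t, y, v)\<close>.\<close>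

definition second_partial_velocity :: "(real \<times> real \<times> real \<Rightarrow> real) \<Rightarrow> real \<times> real \<times> real \<Rightarrow> real" where
  "second_partial_velocity f = (\<lambda>(t, y, v). (deriv ^^ 2) (\<lambda>w. f (t, y, w)) v)"

text \<open>Subdifferential of a function with domain \<open>S\<close> (i.e. extended by \<open>+\<infinity>\<close> outside \<open>S\<close>).\<close>

definition subdifferential_on :: "real set \<Rightarrow> (real \<Rightarrow> real) \<Rightarrow> real \<Rightarrow> real set" where
  "subdifferential_on S x t = {p. \<forall>s\<in>S. x s \<ge> x t + p * (s - t)}"

text \<open>The one-sided limits of the derivative at the ends of \<open>[a;b]\<close>. A convex function is
  differentiable on \<open>(a;b)\<close> only up to a countable set and \<^const>\<open>deriv\<close> is a junk value elsewhere,
  so the limits are taken along the (dense) set of points of differentiability.\<close>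

definition differentiability_points :: "real \<Rightarrow> real \<Rightarrow> (real \<Rightarrow> real) \<Rightarrow> real set" where
  "differentiability_points a b x = {t \<in> {a<..<b}. x differentiable (at t)}"

definition deriv_limit :: "real \<Rightarrow> real \<Rightarrow> (real \<Rightarrow> real) \<Rightarrow> real \<Rightarrow> real \<Rightarrow> bool" where
  "deriv_limit a b x c L \<longleftrightarrow>
     (deriv x \<longlongrightarrow> L) (at c within differentiability_points a b x)"

text \<open>The integrand uses \<^const>\<open>deriv\<close>, which is the genuine derivative of a convex function
  off a null set.\<close>

definition cost :: "(real \<times> real \<times> real \<Rightarrow> real) \<Rightarrow> real \<Rightarrow> real \<Rightarrow> (real \<Rightarrow> real) \<Rightarrow> real" where
  "cost f t0 t1 x = integral {t0..t1} (\<lambda>t. f (t, x t, deriv x t))"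

text \<open>Continuity only matters at the endpoints: it excludes convex functions that jump upwards
  at \<open>t0\<close> or \<open>t1\<close>, for which the boundary values are invisible to the derivative.
  Finite limits suffice below: for convex \<open>x\<close> the limit at \<open>t0\<close> is always \<open>< +\<infinity>\<close>, and being
  \<open>\<ge> s0\<close> excludes \<open>-\<infinity>\<close>; symmetrically at \<open>t1\<close>.\<close>

definition admissible ::
  "(real \<times> real) set \<Rightarrow> real \<Rightarrow> real \<Rightarrow> real \<Rightarrow> real \<Rightarrow> real \<Rightarrow> real \<Rightarrow> (real \<Rightarrow> real) set" where
  "admissible U t0 t1 s0 s1 x0 x1 =
     {x. convex_on {t0..t1} x \<and> continuous_on {t0..t1} x \<and>
         (\<forall>t\<in>{t0..t1}. (t, x t) \<in> U) \<and>
         x t0 = x0 \<and> x t1 = x1 \<and>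
         (\<exists>L. deriv_limit t0 t1 x t0 L \<and> L \<ge> s0) \<and>
         (\<exists>L. deriv_limit t0 t1 x t1 L \<and> L \<le> s1)}"

definition optimal ::
  "(real \<times> real \<times> real \<Rightarrow> real) \<Rightarrow> (real \<times> real) set \<Rightarrow>
   real \<Rightarrow> real \<Rightarrow> real \<Rightarrow> real \<Rightarrow> real \<Rightarrow> real \<Rightarrow> (real \<Rightarrow> real) \<Rightarrow> bool" where
  "optimal f U t0 t1 s0 s1 x0 x1 xh \<longleftrightarrow>
     xh \<in> admissible U t0 t1 s0 s1 x0 x1 \<and>
     (\<forall>x \<in> admissible U t0 t1 s0 s1 x0 x1. cost f t0 t1 xh \<le> cost f t0 t1 x)"

definition Gamma_set :: "real \<Rightarrow> real \<Rightarrow> (real \<Rightarrow> real) \<Rightarrow> (real \<times> real \<times> real) set" where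
  "Gamma_set t0 t1 xh =
     {(t, y, v). t \<in> {t0..t1} \<and> y = xh t \<and> v \<in> subdifferential_on {t0..t1} xh t}"

end

theory Submission
  imports Defs
begin

text \<open>
  At a corner \<open>\<tau>\<close> of the optimal function, with one-sided derivatives \<open>l < r\<close>, replace the function
  on \<open>[\<tau> - h; \<tau> + h]\<close> by its chord. The new function is the maximum of the old one and an affine
  function, hence convex; since \<open>U\<close> is convex, its graph stays in \<open>U\<close>, and nothing changes near the
  endpoints. As \<open>h\<close> tends to \<open>0\<close>, the slope of the chord tends to \<open>(l + r) / 2\<close>, so that with
  \<open>\<phi>(v) = f(\<tau>, x(\<tau>), v)\<close> the cost changes by \<open>h (2 \<phi>((l + r) / 2) - \<phi>(l) - \<phi>(r)) + o(h)\<close>. This is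
  negative for small \<open>h\<close>, because \<open>\<phi>'' > 0\<close> on \<open>[l; r]\<close>, which is the subdifferential at \<open>\<tau>\<close>.
  So there are no corners, and a convex function without corners whose derivative has finite
  limits at the endpoints is continuously differentiable.
\<close>

section \<open>Preliminaries on integrals, local derivatives and strict convexity in the
  velocity\<close>

definition slope :: "(real \<Rightarrow> real) \<Rightarrow> real \<Rightarrow> real \<Rightarrow> real" where
  "slope x s t = (x t - x s) / (t - s)"

lemma countable_imp_negligible:
  fixes S :: "real set"
  assumes "countable S"
  shows "negligible S"
  using countable_imp_null_set_lborel[OF assms] by (simp add: negligible_iff_null_sets null_sets_completionI)

text \<open>Resetting the integrand to \<open>m\<close> on the countable set and at both ends leaves
  its integral unchanged, after which the bound holds everywhere. The form suits integrands
  containing \<open>deriv\<close>, whose values at corners are arbitrary.\<close>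

lemma integral_ge_if_ge_off_countable:
  fixes g :: "real \<Rightarrow> real"
  assumes "g integrable_on {p..q}" "p \<le> q" "countable N"
    and "\<And>t. t \<in> {p<..<q} - N \<Longrightarrow> m \<le> g t"
  shows "m * (q - p) \<le> integral {p..q} g"
proof -
  define g' where "g' t = (if t \<in> {p<..<q} - N then g t else m)" for t
  have neg: "negligible (N \<union> {p, q})"
    using assms(3) by (intro countable_imp_negligible) simp
  have g': "(g' has_integral integral {p..q} g) {p..q}"
    by (rule has_integral_spike[OF neg _ integrable_integral[OF assms(1)]]) (auto simp: g'_def)
  have "((\<lambda>t. m) has_integral m * (q - p)) {p..q}"
    using has_integral_const_real[of m p q] assms(2) by (simp add: mult.commute)
  then show ?thesis
    by (rule has_integral_le[OF _ g']) (use assms(4) in \<open>auto simp: g'_def\<close>)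
qed

lemma differentiable_deriv_local:
  fixes x y :: "real \<Rightarrow> real"
  assumes "open S" "t \<in> S" "\<And>s. s \<in> S \<Longrightarrow> x s = y s"
  shows "x differentiable (at t) \<longleftrightarrow> y differentiable (at t)" "deriv x t = deriv y t"
proof -
  have ev: "eventually (\<lambda>s. x s = y s) (nhds t)"
    using assms eventually_nhds by blast
  have "(x has_real_derivative D) (at t) \<longleftrightarrow> (y has_real_derivative D) (at t)" for D
    by (rule DERIV_cong_ev[OF refl ev refl])
  then show "x differentiable (at t) \<longleftrightarrow> y differentiable (at t)"
    by (simp add: real_differentiable_def)
  show "deriv x t = deriv y t"
    by (rule deriv_cong_ev[OF ev refl])
qed

text \<open>Near \<open>c\<close> both the points of differentiability and the derivatives there
  depend only on the values on \<open>S\<close>. This carries the endpoint conditions over to a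
  function modified only away from the endpoints.\<close>

lemma deriv_limit_local:
  assumes "open S" "c \<in> S" "\<And>t. t \<in> S \<Longrightarrow> x t = y t" "deriv_limit a b x c l"
  shows "deriv_limit a b y c l"
proof -
  note eq = differentiable_deriv_local[OF assms(1) _ assms(3)]
  have "at c within differentiability_points a b x = at c within differentiability_points a b y"
    by (rule at_within_nhd[OF assms(2,1)]) (auto simp: differentiability_points_def eq(1))
  moreover have "eventually (\<lambda>t. deriv x t = deriv y t) (at c within differentiability_points a b y)"
    unfolding eventually_at_topological using eq(2) assms(1,2) by (intro exI[of _ S]) simp
  ultimately show ?thesis
    using assms(4) unfolding deriv_limit_def by (simp add: tendsto_cong)
qed

text \<open>The mean value theorem on each half gives increments proportional to
  \<open>\<phi>' \<xi>\<close> and \<open>\<phi>' \<zeta>\<close> with \<xi> < \<zeta>. The halves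
  have equal length and \<open>\<phi>'\<close> is strictly increasing, so the second increment is
  the larger one.\<close>

lemma midpoint_less_if_second_derivative_pos:
  fixes \<phi> :: "real \<Rightarrow> real"
  assumes "l < r"
    and d1: "\<And>v. v \<in> {l..r} \<Longrightarrow> (\<phi> has_real_derivative \<phi>' v) (at v)"
    and d2: "\<And>v. v \<in> {l..r} \<Longrightarrow> (\<phi>' has_real_derivative \<phi>'' v) (at v)"
    and pos: "\<And>v. v \<in> {l..r} \<Longrightarrow> \<phi>'' v > 0"
  shows "2 * \<phi> ((l + r) / 2) < \<phi> l + \<phi> r"
proof -
  define m where "m = (l + r) / 2"
  have m: "l < m" "m < r" "m - l = (r - l) / 2" "r - m = (r - l) / 2"
    using assms(1) by (simp_all add: m_def field_simps)
  obtain \<xi> where \<xi>: "l < \<xi>" "\<xi> < m" "\<phi> m - \<phi> l = (m - l) * \<phi>' \<xi>"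
    using MVT2[OF m(1), of \<phi> \<phi>'] d1 m by auto
  obtain \<zeta> where \<zeta>: "m < \<zeta>" "\<zeta> < r" "\<phi> r - \<phi> m = (r - m) * \<phi>' \<zeta>"
    using MVT2[OF m(2), of \<phi> \<phi>'] d1 m by auto
  have "\<phi>' \<xi> < \<phi>' \<zeta>"
  proof (rule DERIV_pos_imp_increasing[of \<xi> \<zeta> \<phi>'])
    show "\<xi> < \<zeta>" using \<xi> \<zeta> by simp
    show "\<exists>y. (\<phi>' has_real_derivative y) (at v) \<and> 0 < y" if "\<xi> \<le> v" "v \<le> \<zeta>" for v
      using that d2[of v] pos[of v] \<xi> \<zeta> by (intro exI[of _ "\<phi>'' v"]) auto
  qed
  then have "(r - l) / 2 * \<phi>' \<xi> < (r - l) / 2 * \<phi>' \<zeta>"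
    using assms(1) by (intro mult_strict_left_mono) auto
  then show ?thesis
    using \<xi>(3) \<zeta>(3) unfolding m(3,4) m_def[symmetric] by linarith
qed

text \<open>Restricting \<open>f\<close> to the line in direction \<open>e = (0, 0, 1)\<close> turns
  the Frechet derivatives into ordinary ones: apply the first to \<open>e\<close> once and the
  second to \<open>e\<close> twice. Hence the iterated \<open>deriv\<close> in
  \<open>second_partial_velocity\<close> is a genuine second derivative and not a default
  value.\<close>

lemma C2_function_velocity_derivatives:
  fixes f :: "real \<times> real \<times> real \<Rightarrow> real"
  assumes "C2_function f"
  shows "((\<lambda>w. f (t, y, w)) has_real_derivative deriv (\<lambda>w. f (t, y, w)) v) (at v)"
    and "(deriv (\<lambda>w. f (t, y, w)) has_real_derivative second_partial_velocity f (t, y, v)) (at v)"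
proof -
  obtain f' :: "real \<times> real \<times> real \<Rightarrow> (real \<times> real \<times> real) \<Rightarrow>\<^sub>L real"
    and f'' :: "real \<times> real \<times> real \<Rightarrow> (real \<times> real \<times> real) \<Rightarrow>\<^sub>L ((real \<times> real \<times> real) \<Rightarrow>\<^sub>L real)"
    where f': "\<And>p. (f has_derivative blinfun_apply (f' p)) (at p)"
      and f'': "\<And>p. (f' has_derivative blinfun_apply (f'' p)) (at p)"
    using assms unfolding C2_function_def by blast
  define e :: "real \<times> real \<times> real" where "e = (0, 0, 1)"
  have incl: "((\<lambda>w. (t, y, w)) has_derivative (\<lambda>h. h *\<^sub>R e)) (at w)" for w
    by (auto intro!: derivative_eq_intros simp: e_def)
  have d1: "((\<lambda>w. f (t, y, w)) has_real_derivative f' (t, y, w) e) (at w)" for w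
    using has_derivative_compose[OF incl f'[of "(t, y, w)"]]
    by (simp add: has_field_derivative_def blinfun.scaleR_right mult_commute_abs)
  have deriv1: "deriv (\<lambda>w. f (t, y, w)) = (\<lambda>w. f' (t, y, w) e)"
    using d1 DERIV_imp_deriv by blast
  have "((\<lambda>w. f' (t, y, w)) has_derivative (\<lambda>h. f'' (t, y, v) (h *\<^sub>R e))) (at v)"
    by (rule has_derivative_compose[OF incl f''])
  then have "((\<lambda>w. f' (t, y, w) e) has_derivative (\<lambda>h. f'' (t, y, v) (h *\<^sub>R e) e)) (at v)"
    by (rule bounded_linear.has_derivative[OF blinfun.bounded_linear_left])
  then have d2: "((\<lambda>w. f' (t, y, w) e) has_real_derivative f'' (t, y, v) e e) (at v)"
    by (simp add: has_field_derivative_def blinfun.scaleR_right blinfun.scaleR_left mult_commute_abs)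
  show "((\<lambda>w. f (t, y, w)) has_real_derivative deriv (\<lambda>w. f (t, y, w)) v) (at v)"
    using d1 deriv1 by simp
  have "second_partial_velocity f (t, y, v) = f'' (t, y, v) e e"
    using DERIV_imp_deriv[OF d2] deriv1 by (simp add: second_partial_velocity_def numeral_2_eq_2)
  then show "(deriv (\<lambda>w. f (t, y, w)) has_real_derivative second_partial_velocity f (t, y, v)) (at v)"
    using d2 deriv1 by simp
qed

section \<open>One-sided derivatives of a convex function\<close>

locale convex_interval =
  fixes a b :: real and x :: "real \<Rightarrow> real"
  assumes ab: "a < b"
    and conv: "convex_on {a..b} x"
    and cont: "continuous_on {a..b} x"
begin

text \<open>By convexity the slope from \<open>t\<close> to \<open>s\<close> increases with
  \<open>s\<close>, so at interior points the infimum is the limit as \<open>s\<close> decreases to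
  \<open>t\<close>, that is, the right derivative. Taking an infimum makes order estimates available
  before any limit is known to exist.\<close>

definition rderiv :: "real \<Rightarrow> real" where
  "rderiv t = (INF s\<in>{t<..b}. slope x t s)"

definition lderiv :: "real \<Rightarrow> real" where
  "lderiv t = (SUP s\<in>{a..<t}. slope x s t)"

lemma slope_mono:
  assumes "s \<in> {a..b}" "u \<in> {a..b}" "s < t" "t < u"
  shows "slope x s t \<le> slope x s u" "slope x s u \<le> slope x t u"
  using convex_on_slope_le[OF conv assms]
  by (simp_all add: slope_def minus_divide_divide[of "x s - x t" "s - t", symmetric]
      minus_divide_divide[of "x s - x u" "s - u", symmetric]
      minus_divide_divide[of "x t - x u" "t - u", symmetric])

lemma slope_le_slope:
  assumes "s \<in> {a..b}" "u \<in> {a..b}" "s < t" "t < u"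
  shows "slope x s t \<le> slope x t u"
  using slope_mono[OF assms] by linarith

lemma slope_tendsto:
  assumes "t \<in> {a<..<b}" "u \<noteq> t"
  shows "((\<lambda>s. slope x s u) \<longlongrightarrow> slope x t u) (at t)" "((\<lambda>s. slope x u s) \<longlongrightarrow> slope x u t) (at t)"
proof -
  have "isCont x t"
    using cont assms(1) continuous_on_interior[of "{a..b}" x t] by simp
  then show "((\<lambda>s. slope x s u) \<longlongrightarrow> slope x t u) (at t)" "((\<lambda>s. slope x u s) \<longlongrightarrow> slope x u t) (at t)"
    unfolding slope_def using assms(2) by (auto intro!: tendsto_eq_intros simp: isCont_def)
qed

text \<open>The slope from the auxiliary point \<open>t0\<close> on the left of \<open>t\<close>
  bounds all slopes to the right from below, so the infimum is not taken over an unbounded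
  set.\<close>

lemma rderiv_le_slope:
  assumes "a \<le> t0" "t0 < t" "t < u" "u \<le> b"
  shows "rderiv t \<le> slope x t u"
  unfolding rderiv_def
proof (rule cINF_lower)
  show "bdd_below (slope x t ` {t<..b})"
    using slope_le_slope[of t0 _ t] assms by (intro bdd_belowI[of _ "slope x t0 t"]) auto
qed (use assms in auto)

lemma slope_le_lderiv:
  assumes "a \<le> s" "s < t" "t < b"
  shows "slope x s t \<le> lderiv t"
  unfolding lderiv_def
proof (rule cSUP_upper)
  show "bdd_above ((\<lambda>s. slope x s t) ` {a..<t})"
    using slope_le_slope[of _ b t] assms by (intro bdd_aboveI[of _ "slope x t b"]) auto
qed (use assms in auto)

lemma lderiv_le_rderiv:
  assumes "t \<in> {a<..<b}"
  shows "lderiv t \<le> rderiv t"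
  unfolding lderiv_def rderiv_def using assms
  by (intro cSUP_least cINF_greatest) (auto intro!: slope_le_slope)

lemma slope_le_rderiv:
  assumes "a \<le> s" "s < t" "t < b"
  shows "slope x s t \<le> rderiv t"
  using slope_le_lderiv[OF assms] lderiv_le_rderiv[of t] assms by simp

lemma lderiv_le_slope:
  assumes "a < t" "t < u" "u \<le> b"
  shows "lderiv t \<le> slope x t u"
  using rderiv_le_slope[of a t u] lderiv_le_rderiv[of t] assms by simp

text \<open>The slope of the chord from \<open>s\<close> to \<open>t\<close> separates the two.
  Together with \<open>lderiv_le_rderiv\<close> this gives the interlacing lderiv s \<le> rderiv s
  \<le> lderiv t \<le> rderiv t, on which the monotonicity and sandwich arguments rest.\<close>

lemma rderiv_le_lderiv:
  assumes "a < s" "s < t" "t < b"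
  shows "rderiv s \<le> lderiv t"
  using rderiv_le_slope[of a s t] slope_le_lderiv[of s t] assms by simp

lemma mono_on_rderiv: "mono_on {a<..<b} rderiv"
proof (rule mono_onI)
  fix s t assume "s \<in> {a<..<b}" "t \<in> {a<..<b}" "s \<le> t"
  then show "rderiv s \<le> rderiv t"
    using rderiv_le_lderiv[of s t] lderiv_le_rderiv[of t] by (cases "s = t") auto
qed

text \<open>Monotonicity gives the lower estimate. For the upper one, fix a chord from
  \<open>t\<close> to \<open>u\<close> with slope below \<open>c\<close>; by continuity of
  \<open>x\<close> the slope stays below \<open>c\<close> when the left end moves to a nearby
  \<open>s\<close>, and it bounds \<open>rderiv s\<close> from above.\<close>

lemma rderiv_tendsto_right:
  assumes t: "t \<in> {a<..<b}"
  shows "(rderiv \<longlongrightarrow> rderiv t) (at_right t)"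
proof (rule order_tendstoI)
  fix c assume "c < rderiv t"
  then show "eventually (\<lambda>s. c < rderiv s) (at_right t)"
    unfolding eventually_at_right_field
    using mono_onD[OF mono_on_rderiv t] t by (intro exI[of _ b]) force
next
  fix c assume c: "rderiv t < c"
  have "\<exists>u\<in>{t<..b}. slope x t u < c"
  proof (rule ccontr)
    assume "\<not> ?thesis"
    then have "c \<le> rderiv t"
      unfolding rderiv_def using t by (intro cINF_greatest) (auto simp: not_less)
    with c show False by simp
  qed
  then obtain u where u: "t < u" "u \<le> b" "slope x t u < c"
    by auto
  have "eventually (\<lambda>s. slope x s u < c) (at_right t)"
    using order_tendstoD(2)[OF slope_tendsto(1)[OF t] u(3)] u(1)
    by (auto simp: eventually_at_split)
  moreover have "eventually (\<lambda>s. s \<in> {t<..<u}) (at_right t)"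
    using u(1) by (rule eventually_at_right_real)
  ultimately show "eventually (\<lambda>s. rderiv s < c) (at_right t)"
  proof eventually_elim
    case (elim s)
    then have "rderiv s \<le> slope x s u"
      using rderiv_le_slope[of a s u] t u by simp
    with elim show ?case by simp
  qed
qed

lemma lderiv_tendsto_left:
  assumes t: "t \<in> {a<..<b}"
  shows "(lderiv \<longlongrightarrow> lderiv t) (at_left t)"
proof (rule order_tendstoI)
  fix c assume "lderiv t < c"
  then show "eventually (\<lambda>s. lderiv s < c) (at_left t)"
    unfolding eventually_at_left_field
    using rderiv_le_lderiv[of _ t] lderiv_le_rderiv t by (intro exI[of _ a]) force
next
  fix c assume c: "c < lderiv t"
  have "\<exists>u\<in>{a..<t}. c < slope x u t"
  proof (rule ccontr)
    assume "\<not> ?thesis"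
    then have "lderiv t \<le> c"
      unfolding lderiv_def using t by (intro cSUP_least) (auto simp: not_less)
    with c show False by simp
  qed
  then obtain u where u: "a \<le> u" "u < t" "c < slope x u t"
    by auto
  have "eventually (\<lambda>s. c < slope x u s) (at_left t)"
    using order_tendstoD(1)[OF slope_tendsto(2)[OF t] u(3)] u(2)
    by (auto simp: eventually_at_split)
  moreover have "eventually (\<lambda>s. s \<in> {u<..<t}) (at_left t)"
    using u(2) by (rule eventually_at_left_real)
  ultimately show "eventually (\<lambda>s. c < lderiv s) (at_left t)"
    by eventually_elim (use slope_le_lderiv[of u] t u in force)
qed

text \<open>By interlacing, \<open>rderiv s\<close> lies between \<open>lderiv s\<close> and
  \<open>lderiv t\<close> for \<open>s < t\<close>. Thus the single monotone function
  \<open>rderiv\<close> describes the derivative on both sides of a corner.\<close>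

lemma rderiv_tendsto_left:
  assumes t: "t \<in> {a<..<b}"
  shows "(rderiv \<longlongrightarrow> lderiv t) (at_left t)"
proof (rule tendsto_sandwich[OF _ _ lderiv_tendsto_left[OF t] tendsto_const])
  have "eventually (\<lambda>s. s \<in> {a<..<t}) (at_left t)"
    using t by (intro eventually_at_left_real) simp
  then show "eventually (\<lambda>s. lderiv s \<le> rderiv s) (at_left t)" "eventually (\<lambda>s. rderiv s \<le> lderiv t) (at_left t)"
    by (eventually_elim; use rderiv_le_lderiv[of _ t] lderiv_le_rderiv t in force)+
qed

text \<open>The slope from \<open>t\<close> to \<open>s\<close> is squeezed between
  \<open>rderiv t\<close> and \<open>rderiv s\<close>, and \<open>rderiv\<close> is continuous from
  the right.\<close>

lemma has_right_derivative:
  assumes t: "t \<in> {a<..<b}"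
  shows "(x has_real_derivative rderiv t) (at_right t)"
  unfolding has_field_derivative_iff slope_def[symmetric]
proof (rule tendsto_sandwich[OF _ _ tendsto_const rderiv_tendsto_right[OF t]])
  have "eventually (\<lambda>s. s \<in> {t<..<b}) (at_right t)"
    using t by (intro eventually_at_right_real) simp
  then show "eventually (\<lambda>s. rderiv t \<le> slope x t s) (at_right t)"
    "eventually (\<lambda>s. slope x t s \<le> rderiv s) (at_right t)"
    by (eventually_elim; use rderiv_le_slope[of a t] slope_le_rderiv[of t] t in force)+
qed

lemma has_left_derivative:
  assumes t: "t \<in> {a<..<b}"
  shows "(x has_real_derivative lderiv t) (at_left t)"
proof -
  have "((\<lambda>s. slope x s t) \<longlongrightarrow> lderiv t) (at_left t)"
  proof (rule tendsto_sandwich[OF _ _ lderiv_tendsto_left[OF t] tendsto_const])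
    have "eventually (\<lambda>s. s \<in> {a<..<t}) (at_left t)"
      using t by (intro eventually_at_left_real) simp
    then show "eventually (\<lambda>s. slope x s t \<le> lderiv t) (at_left t)"
      "eventually (\<lambda>s. lderiv s \<le> slope x s t) (at_left t)"
      by (eventually_elim; use lderiv_le_slope[of _ t] slope_le_lderiv[of _ t] t in force)+
  qed
  moreover have "slope x s t = (x s - x t) / (s - t)" for s
    unfolding slope_def by (metis minus_diff_eq minus_divide_divide)
  ultimately show ?thesis
    by (simp add: has_field_derivative_iff)
qed

section \<open>Points of differentiability and integrability along the derivative\<close>

lemma has_derivative_if_no_corner:
  assumes "t \<in> {a<..<b}" "lderiv t = rderiv t"
  shows "(x has_real_derivative rderiv t) (at t)"
  using has_left_derivative[of t] has_right_derivative[of t] assms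
  unfolding has_field_derivative_iff by (simp add: filterlim_split_at)

lemma deriv_eq_rderiv:
  assumes "t \<in> {a<..<b}" "x differentiable (at t)"
  shows "deriv x t = rderiv t"
proof -
  have "(x has_real_derivative deriv x t) (at_right t)"
    using assms(2) DERIV_deriv_iff_real_differentiable has_field_derivative_at_within by blast
  then show ?thesis
    using has_right_derivative[OF assms(1)] unfolding has_field_derivative_iff
    by (rule tendsto_unique[OF trivial_limit_at_right_real])
qed

text \<open>Where the monotone function \<open>rderiv\<close> is continuous, its left limit
  \<open>lderiv t\<close> equals its value, so there is no corner. A monotone function has only
  countably many discontinuities.\<close>

lemma countable_nondifferentiable: "countable {t \<in> {a<..<b}. \<not> x differentiable (at t)}"
proof (rule countable_subset[OF _ mono_on_ctble_discont_open[OF _ mono_on_rderiv]])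
  show "{t \<in> {a<..<b}. \<not> x differentiable (at t)} \<subseteq> {t \<in> {a<..<b}. \<not> isCont rderiv t}"
  proof clarify
    fix t assume t: "t \<in> {a<..<b}" and "\<not> x differentiable (at t)" and isCont: "isCont rderiv t"
    have "(rderiv \<longlongrightarrow> rderiv t) (at_left t)"
      using isCont by (simp add: isCont_def filterlim_at_split)
    then have "lderiv t = rderiv t"
      by (rule tendsto_unique[OF trivial_limit_at_left_real rderiv_tendsto_left[OF t]])
    then show False
      using has_derivative_if_no_corner t \<open>\<not> x differentiable (at t)\<close> real_differentiable_def by blast
  qed
qed simp

lemma ex_differentiable:
  assumes "a \<le> p" "p < q" "q \<le> b"
  shows "\<exists>c\<in>{p<..<q}. x differentiable (at c)"
proof (rule ccontr)
  assume "\<not> ?thesis"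
  then have "{p<..<q} \<subseteq> {t \<in> {a<..<b}. \<not> x differentiable (at t)}"
    using assms by auto
  then have "countable {p<..<q}"
    using countable_nondifferentiable countable_subset by blast
  then show False
    using uncountable_open_interval[of p q] assms(2) by simp
qed

text \<open>The limits bound \<open>deriv\<close> from below near \<open>a\<close> and from above
  near \<open>b\<close>. Points of differentiability exist arbitrarily close to each end, and
  monotonicity of \<open>rderiv\<close> spreads both bounds over the whole open interval.\<close>

lemma rderiv_bounded_if_deriv_limits:
  assumes "deriv_limit a b x a l" "deriv_limit a b x b m"
  obtains B where "\<And>t. t \<in> {a<..<b} \<Longrightarrow> \<bar>rderiv t\<bar> \<le> B"
proof -
  obtain d where d: "d > 0"
    "\<And>t. t \<in> differentiability_points a b x \<Longrightarrow> t \<noteq> a \<Longrightarrow> dist t a < d \<Longrightarrow> l - 1 < deriv x t"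
    using order_tendstoD(1)[OF assms(1)[unfolded deriv_limit_def], of "l - 1"]
    by (auto simp: eventually_at)
  obtain e where e: "e > 0"
    "\<And>t. t \<in> differentiability_points a b x \<Longrightarrow> t \<noteq> b \<Longrightarrow> dist t b < e \<Longrightarrow> deriv x t < m + 1"
    using order_tendstoD(2)[OF assms(2)[unfolded deriv_limit_def], of "m + 1"]
    by (auto simp: eventually_at)
  have "l - 1 \<le> rderiv t" if t: "t \<in> {a<..<b}" for t
  proof -
    obtain c where c: "c \<in> {a<..<min t (a + d)}" "x differentiable (at c)"
      using ex_differentiable[of a "min t (a + d)"] t d(1) by fastforce
    then have "l - 1 < rderiv c"
      using d(2)[of c] deriv_eq_rderiv[of c] t by (auto simp: differentiability_points_def dist_real_def)
    also have "rderiv c \<le> rderiv t"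
      using mono_onD[OF mono_on_rderiv, of c t] c t by auto
    finally show ?thesis by simp
  qed
  moreover have "rderiv t \<le> m + 1" if t: "t \<in> {a<..<b}" for t
  proof -
    obtain c where c: "c \<in> {max t (b - e)<..<b}" "x differentiable (at c)"
      using ex_differentiable[of "max t (b - e)" b] t e(1) by fastforce
    have "rderiv t \<le> rderiv c"
      using mono_onD[OF mono_on_rderiv, of t c] c t by auto
    also have "rderiv c < m + 1"
      using e(2)[of c] deriv_eq_rderiv[of c] c t by (auto simp: differentiability_points_def dist_real_def)
    finally show ?thesis by simp
  qed
  ultimately show thesis
    by (intro that[of "\<bar>l - 1\<bar> + \<bar>m + 1\<bar>"]) (smt (verit))
qed

text \<open>Along \<open>rderiv\<close> the integrand is measurable and takes its arguments in a
  compact set, so it is bounded; \<open>deriv\<close> agrees with \<open>rderiv\<close> off a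
  countable set. Costs can then be subtracted and split, which the default value of
  \<open>integral\<close> for a nonintegrable function would not permit.\<close>

lemma integrable_along_deriv:
  fixes f :: "real \<times> real \<times> real \<Rightarrow> real"
  assumes f: "continuous_on UNIV f" and B: "\<And>t. t \<in> {a<..<b} \<Longrightarrow> \<bar>rderiv t\<bar> \<le> B"
  shows "(\<lambda>t. f (t, x t, deriv x t)) integrable_on {a..b}"
proof -
  have "compact (f ` ({a..b} \<times> x ` {a..b} \<times> {-B..B}))"
    by (intro compact_continuous_image compact_Times continuous_on_subset[OF f] cont) auto
  then obtain K where K: "\<And>z. z \<in> {a..b} \<times> x ` {a..b} \<times> {-B..B} \<Longrightarrow> \<bar>f z\<bar> \<le> K"
    by (force dest!: compact_imp_bounded simp: bounded_iff)
  \<comment> \<open>A monotone function is Borel measurable; the Lebesgue sets form a larger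
    sigma-algebra on the same interval.\<close>
  have "rderiv \<in> borel_measurable (lebesgue_on {a<..<b})"
    using borel_measurable_mono_on_fnc[OF mono_on_rderiv]
    by (rule borel_measurable_subalgebra[rotated 2])
      (auto simp: space_restrict_space intro!: mono_restrict_space)
  moreover have "x \<in> borel_measurable (lebesgue_on {a<..<b})"
    by (intro continuous_imp_measurable_on_sets_lebesgue continuous_on_subset[OF cont]) auto
  moreover have "(\<lambda>t. t) \<in> borel_measurable (lebesgue_on {a<..<b})"
    by (intro continuous_imp_measurable_on_sets_lebesgue) auto
  ultimately have "(\<lambda>t. (t, x t, rderiv t)) \<in> borel_measurable (lebesgue_on {a<..<b})"
    by (intro borel_measurable_Pair)
  then have "(\<lambda>t. f (t, x t, rderiv t)) \<in> borel_measurable (lebesgue_on {a<..<b})"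
    by (rule borel_measurable_continuous_on[OF f])
  then have "(\<lambda>t. f (t, x t, rderiv t)) integrable_on {a<..<b}"
  proof (rule measurable_bounded_by_integrable_imp_integrable_real)
    show "(\<lambda>t. K) integrable_on {a<..<b}"
      by (simp add: integrable_on_open_interval_real integrable_const_ivl)
    show "\<bar>f (t, x t, rderiv t)\<bar> \<le> K" if "t \<in> {a<..<b}" for t
      using that B[OF that] by (intro K) (auto simp: abs_le_iff)
  qed simp
  then have "(\<lambda>t. f (t, x t, rderiv t)) integrable_on {a..b}"
    by (simp add: integrable_on_open_interval_real)
  then show ?thesis
  proof (rule integrable_spike)
    show "negligible ({t \<in> {a<..<b}. \<not> x differentiable (at t)} \<union> {a, b})"
      using countable_nondifferentiable by (intro countable_imp_negligible) simp
  qed (use deriv_eq_rderiv in auto)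
qed

section \<open>Replacing an arc of the graph by its chord\<close>

definition cut :: "real \<Rightarrow> real \<Rightarrow> real \<Rightarrow> real" where
  "cut p q t = (if t \<in> {p..q} then x p + slope x p q * (t - p) else x t)"

text \<open>Monotonicity of slopes puts the line through the chord above the graph between
  \<open>p\<close> and \<open>q\<close> and below it elsewhere. Convexity and continuity across
  \<open>p\<close> and \<open>q\<close> can be read off from the maximum.\<close>

lemma cut_eq_max:
  assumes "a \<le> p" "p < q" "q \<le> b" "t \<in> {a..b}"
  shows "cut p q t = max (x t) (x p + slope x p q * (t - p))"
proof -
  have chord_q: "x p + slope x p q * (q - p) = x q"
    using assms by (simp add: slope_def)
  consider "t < p" | "t = p" | "p < t" "t < q" | "t = q" | "q < t"
    by linarith
  then show ?thesis
  proof cases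
    case 1
    then have "slope x t p * (p - t) \<le> slope x p q * (p - t)"
      using slope_le_slope[of t q p] assms by (intro mult_right_mono) auto
    moreover have "slope x t p * (p - t) = x p - x t"
      using 1 by (simp add: slope_def)
    moreover have "slope x p q * (p - t) = - (slope x p q * (t - p))"
      by (simp add: algebra_simps)
    ultimately have "x p + slope x p q * (t - p) \<le> x t"
      by linarith
    then show ?thesis
      using 1 by (simp add: cut_def)
  next
    case 3
    then have "slope x p t * (t - p) \<le> slope x p q * (t - p)"
      using slope_mono(1)[of p q t] assms by (intro mult_right_mono) auto
    then show ?thesis
      using 3 by (simp add: cut_def slope_def[of x p t])
  next
    case 5
    then have "slope x p q * (t - p) \<le> slope x p t * (t - p)"
      using slope_mono(1)[of p t q] assms by (intro mult_right_mono) auto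
    then show ?thesis
      using 5 assms by (simp add: cut_def slope_def[of x p t])
  qed (use assms chord_q in \<open>auto simp: cut_def\<close>)
qed

lemma convex_on_cut:
  assumes "a \<le> p" "p < q" "q \<le> b"
  shows "convex_on {a..b} (cut p q)"
proof -
  define l where "l t = x p + slope x p q * (t - p)" for t
  have cut: "cut p q t = max (x t) (l t)" if "t \<in> {a..b}" for t
    using cut_eq_max[OF assms that] by (simp add: l_def)
  show ?thesis
  proof (rule convex_onI)
    fix u s t :: real assume u: "0 < u" "u < 1" and st: "s \<in> {a..b}" "t \<in> {a..b}"
    have "x ((1 - u) *\<^sub>R s + u *\<^sub>R t) \<le> (1 - u) * x s + u * x t"
      using convex_onD[OF conv _ _ st, of u] u by simp
    also have "\<dots> \<le> (1 - u) * max (x s) (l s) + u * max (x t) (l t)"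
      using u by (intro add_mono mult_left_mono) auto
    finally have 1: "x ((1 - u) *\<^sub>R s + u *\<^sub>R t) \<le> \<dots>" .
    have "l ((1 - u) *\<^sub>R s + u *\<^sub>R t) = (1 - u) * l s + u * l t"
      by (simp add: l_def algebra_simps)
    also have "\<dots> \<le> (1 - u) * max (x s) (l s) + u * max (x t) (l t)"
      using u by (intro add_mono mult_left_mono) auto
    finally have 2: "l ((1 - u) *\<^sub>R s + u *\<^sub>R t) \<le> \<dots>" .
    have "(1 - u) *\<^sub>R s + u *\<^sub>R t \<in> {a..b}"
      using convexD_alt[of "{a..b}" s t u] st u by simp
    then show "cut p q ((1 - u) *\<^sub>R s + u *\<^sub>R t) \<le> (1 - u) * cut p q s + u * cut p q t"
      using 1 2 st by (simp only: cut max.bounded_iff)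
  qed simp
qed

lemma continuous_on_cut:
  assumes "a \<le> p" "p < q" "q \<le> b"
  shows "continuous_on {a..b} (cut p q)"
proof -
  have "continuous_on {a..b} (\<lambda>t. max (x t) (x p + slope x p q * (t - p)))"
    by (intro continuous_intros cont)
  then show ?thesis
    by (rule continuous_on_eq) (simp add: cut_eq_max[OF assms])
qed

text \<open>The same weight \<open>u\<close> serves the time and the value, so a point of the chord
  inherits membership in any convex set containing both of its ends.\<close>

lemma cut_convex_combination:
  assumes "p < q" "t \<in> {p..q}"
  obtains u where "u \<in> {0..1}" "t = (1 - u) * p + u * q" "cut p q t = (1 - u) * x p + u * x q"
proof
  let ?u = "(t - p) / (q - p)"
  show "?u \<in> {0..1}"
    using assms by (auto simp: divide_simps)
  have "?u * (q - p) = t - p"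
    using assms by simp
  then show "t = (1 - ?u) * p + ?u * q"
    by (simp only: left_diff_distrib right_diff_distrib)
  have "slope x p q * (t - p) = ?u * (x q - x p)"
    by (simp add: slope_def)
  then show "cut p q t = (1 - ?u) * x p + ?u * x q"
    using assms by (simp only: cut_def if_True left_diff_distrib right_diff_distrib)
qed

lemma deriv_limit_cut:
  assumes "a < p" "q < b"
  shows "deriv_limit a b x a l \<Longrightarrow> deriv_limit a b (cut p q) a l"
    and "deriv_limit a b x b l \<Longrightarrow> deriv_limit a b (cut p q) b l"
  by (rule deriv_limit_local[of "{..<p}"]; use assms in \<open>simp add: cut_def\<close>)
    (rule deriv_limit_local[of "{q<..}"]; use assms in \<open>simp add: cut_def\<close>)

text \<open>Chord points lie in \<open>U\<close> by convexity. Since \<open>a < p\<close> and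
  \<open>q < b\<close>, the function is unchanged near both endpoints, which preserves the boundary
  values and the limits of the derivative.\<close>

lemma cut_admissible:
  assumes "x \<in> admissible U a b s0 s1 x0 x1" "convex U" "a < p" "p < q" "q < b"
  shows "cut p q \<in> admissible U a b s0 s1 x0 x1"
proof -
  have U: "(t, x t) \<in> U" if "t \<in> {a..b}" for t
    using assms(1) that by (simp add: admissible_def)
  have "(t, cut p q t) \<in> U" if t: "t \<in> {a..b}" for t
  proof (cases "t \<in> {p..q}")
    case True
    then obtain u where u: "u \<in> {0..1}" "t = (1 - u) * p + u * q" "cut p q t = (1 - u) * x p + u * x q"
      using cut_convex_combination assms(4) by blast
    have "(1 - u) *\<^sub>R (p, x p) + u *\<^sub>R (q, x q) \<in> U"
      using u(1) assms by (intro convexD_alt U) auto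
    then show ?thesis
      using u(2,3) by simp
  next
    case False
    then show ?thesis
      using U[OF t] by (auto simp: cut_def)
  qed
  moreover have "cut p q a = x a" "cut p q b = x b"
    using assms by (simp_all add: cut_def)
  ultimately show ?thesis
    using assms convex_on_cut[of p q] continuous_on_cut[of p q] deriv_limit_cut[of p q]
    unfolding admissible_def by auto
qed

lemma deriv_cut_inside:
  assumes "t \<in> {p<..<q}"
  shows "deriv (cut p q) t = slope x p q"
proof -
  have "deriv (cut p q) t = deriv (\<lambda>s. x p + slope x p q * (s - p)) t"
    by (rule differentiable_deriv_local[of "{p<..<q}"]) (use assms in \<open>auto simp: cut_def\<close>)
  also have "\<dots> = slope x p q"
    by (rule DERIV_imp_deriv) (auto intro!: derivative_eq_intros)
  finally show ?thesis .
qed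

section \<open>Cutting off a corner lowers the cost\<close>

lemma corner_not_optimal:
  assumes C2: "C2_function f"
    and lim: "deriv_limit a b x a l" "deriv_limit a b x b m"
    and \<tau>: "\<tau> \<in> {a<..<b}"
    and corner: "lderiv \<tau> < rderiv \<tau>"
    and pos: "\<And>v. v \<in> {lderiv \<tau>..rderiv \<tau>} \<Longrightarrow> second_partial_velocity f (\<tau>, x \<tau>, v) > 0"
  obtains p q where "a < p" "p < q" "q < b" "cost f a b (cut p q) < cost f a b x"
proof -
  define \<phi> where "\<phi> v = f (\<tau>, x \<tau>, v)" for v
  define c where "c = (lderiv \<tau> + rderiv \<tau>) / 2"
  \<comment> \<open>The convexity gap is 8\<eta>. Each integrand is estimated with error \<eta>,
    which costs 2\<eta> h on each half of length \<open>h\<close>; a gain of 4\<eta> h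
    remains.\<close>
  define \<eta> where "\<eta> = (\<phi> (lderiv \<tau>) + \<phi> (rderiv \<tau>) - 2 * \<phi> c) / 8"
  have "2 * \<phi> c < \<phi> (lderiv \<tau>) + \<phi> (rderiv \<tau>)"
    unfolding c_def \<phi>_def
    by (rule midpoint_less_if_second_derivative_pos[OF corner C2_function_velocity_derivatives[OF C2] pos])
  then have \<eta>: "\<eta> > 0"
    by (simp add: \<eta>_def)
  have contf: "continuous_on UNIV f"
    using C2 unfolding C2_function_def by (meson continuous_at_imp_continuous_on has_derivative_continuous)
  then have isCont: "isCont f z" for z
    using continuous_on_eq_continuous_at[OF open_UNIV] by blast
  have x_tau: "(x \<longlongrightarrow> x \<tau>) (at \<tau>)"
    using cont \<tau> continuous_on_interior[of "{a..b}" x \<tau>] by (simp add: isCont_def)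

  \<comment> \<open>Time, value and slope of the chord are controlled separately, hence a product
    neighbourhood, which is then shrunk to balls of a common radius \<rho>.\<close>
  obtain A B C where ABC: "open A" "open B" "open C" "\<tau> \<in> A" "x \<tau> \<in> B" "c \<in> C"
    "A \<times> B \<times> C \<subseteq> {z. f z < \<phi> c + \<eta>}"
  proof -
    have "open {z. f z < \<phi> c + \<eta>}"
      by (intro open_Collect_less contf continuous_intros)
    moreover have "(\<tau>, x \<tau>, c) \<in> {z. f z < \<phi> c + \<eta>}"
      using \<eta> by (simp add: \<phi>_def)
    ultimately obtain A D where AD: "open A" "open D" "(\<tau>, x \<tau>, c) \<in> A \<times> D" "A \<times> D \<subseteq> {z. f z < \<phi> c + \<eta>}"
      by (rule open_prod_elim)
    obtain B C where "open B" "open C" "(x \<tau>, c) \<in> B \<times> C" "B \<times> C \<subseteq> D"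
      using open_prod_elim[OF AD(2), of "(x \<tau>, c)"] AD(3) by auto
    with AD show thesis
      by (intro that[of A B C]) auto
  qed
  obtain r1 r2 r3 where "r1 > 0" "ball \<tau> r1 \<subseteq> A" "r2 > 0" "ball (x \<tau>) r2 \<subseteq> B" "r3 > 0" "ball c r3 \<subseteq> C"
    using ABC open_contains_ball by metis
  then obtain \<rho> where \<rho>: "\<rho> > 0" "ball \<tau> \<rho> \<subseteq> A" "ball (x \<tau>) \<rho> \<subseteq> B" "ball c \<rho> \<subseteq> C"
    using that[of "min r1 (min r2 r3)"] by (auto simp: subset_eq)
  have near: "f (t, y, v) < \<phi> c + \<eta>" if "t \<in> ball \<tau> \<rho>" "y \<in> ball (x \<tau>) \<rho>" "v \<in> ball c \<rho>" for t y v
    using that \<rho> ABC(7) by blast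

  have slope_eq: "slope x s \<tau> = (x s - x \<tau>) / (s - \<tau>)" for s
    unfolding slope_def by (metis minus_diff_eq minus_divide_divide)
  \<comment> \<open>The velocity is written as \<open>rderiv\<close>, which has the limit
    \<open>lderiv \<tau>\<close> from the left; it may be exchanged for \<open>deriv\<close> off a
    countable set later.\<close>
  have "eventually (\<lambda>s. a < s \<and> s \<in> ball \<tau> \<rho> \<and> x s \<in> ball (x \<tau>) \<rho> \<and> \<bar>slope x s \<tau> - lderiv \<tau>\<bar> < \<rho>
      \<and> \<phi> (lderiv \<tau>) - \<eta> < f (s, x s, rderiv s)) (at_left \<tau>)"
  proof (intro eventually_conj)
    show "eventually (\<lambda>s. a < s) (at_left \<tau>)"
      using \<tau> eventually_at_left_field greaterThanLessThan_iff by blast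
    show "eventually (\<lambda>s. s \<in> ball \<tau> \<rho>) (at_left \<tau>)"
      by (rule topological_tendstoD[OF tendsto_ident_at]) (use \<rho> in auto)
    show "eventually (\<lambda>s. x s \<in> ball (x \<tau>) \<rho>) (at_left \<tau>)"
      by (rule topological_tendstoD[OF tendsto_within_subset[OF x_tau]]) (use \<rho> in auto)
    have "(slope x s \<tau> - lderiv \<tau>) = (x s - x \<tau>) / (s - \<tau>) - lderiv \<tau>" for s
      by (simp add: slope_eq)
    then show "eventually (\<lambda>s. \<bar>slope x s \<tau> - lderiv \<tau>\<bar> < \<rho>) (at_left \<tau>)"
      using tendstoD[OF has_field_derivativeD[OF has_left_derivative[OF \<tau>]] \<rho>(1)] by (simp add: dist_real_def)
    have "((\<lambda>s. f (s, x s, rderiv s)) \<longlongrightarrow> \<phi> (lderiv \<tau>)) (at_left \<tau>)"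
      unfolding \<phi>_def
      by (intro isCont_tendsto_compose[OF isCont] tendsto_Pair tendsto_ident_at
          rderiv_tendsto_left[OF \<tau>] tendsto_within_subset[OF x_tau]) simp
    then show "eventually (\<lambda>s. \<phi> (lderiv \<tau>) - \<eta> < f (s, x s, rderiv s)) (at_left \<tau>)"
      by (rule order_tendstoD) (use \<eta> in simp)
  qed
  then obtain b1 where b1: "b1 < \<tau>"
    and left: "\<And>s. b1 < s \<Longrightarrow> s < \<tau> \<Longrightarrow> a < s \<and> s \<in> ball \<tau> \<rho> \<and> x s \<in> ball (x \<tau>) \<rho>
      \<and> \<bar>slope x s \<tau> - lderiv \<tau>\<bar> < \<rho> \<and> \<phi> (lderiv \<tau>) - \<eta> < f (s, x s, rderiv s)"
    unfolding eventually_at_left_field by blast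
  have "eventually (\<lambda>s. s < b \<and> s \<in> ball \<tau> \<rho> \<and> x s \<in> ball (x \<tau>) \<rho> \<and> \<bar>slope x \<tau> s - rderiv \<tau>\<bar> < \<rho>
      \<and> \<phi> (rderiv \<tau>) - \<eta> < f (s, x s, rderiv s)) (at_right \<tau>)"
  proof (intro eventually_conj)
    show "eventually (\<lambda>s. s < b) (at_right \<tau>)"
      using \<tau> eventually_at_right_field greaterThanLessThan_iff by blast
    show "eventually (\<lambda>s. s \<in> ball \<tau> \<rho>) (at_right \<tau>)"
      by (rule topological_tendstoD[OF tendsto_ident_at]) (use \<rho> in auto)
    show "eventually (\<lambda>s. x s \<in> ball (x \<tau>) \<rho>) (at_right \<tau>)"
      by (rule topological_tendstoD[OF tendsto_within_subset[OF x_tau]]) (use \<rho> in auto)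
    show "eventually (\<lambda>s. \<bar>slope x \<tau> s - rderiv \<tau>\<bar> < \<rho>) (at_right \<tau>)"
      using tendstoD[OF has_field_derivativeD[OF has_right_derivative[OF \<tau>]] \<rho>(1)]
      by (simp add: dist_real_def slope_def)
    have "((\<lambda>s. f (s, x s, rderiv s)) \<longlongrightarrow> \<phi> (rderiv \<tau>)) (at_right \<tau>)"
      unfolding \<phi>_def
      by (intro isCont_tendsto_compose[OF isCont] tendsto_Pair tendsto_ident_at
          rderiv_tendsto_right[OF \<tau>] tendsto_within_subset[OF x_tau]) simp
    then show "eventually (\<lambda>s. \<phi> (rderiv \<tau>) - \<eta> < f (s, x s, rderiv s)) (at_right \<tau>)"
      by (rule order_tendstoD) (use \<eta> in simp)
  qed
  then obtain b2 where b2: "\<tau> < b2"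
    and right: "\<And>s. \<tau> < s \<Longrightarrow> s < b2 \<Longrightarrow> s < b \<and> s \<in> ball \<tau> \<rho> \<and> x s \<in> ball (x \<tau>) \<rho>
      \<and> \<bar>slope x \<tau> s - rderiv \<tau>\<bar> < \<rho> \<and> \<phi> (rderiv \<tau>) - \<eta> < f (s, x s, rderiv s)"
    unfolding eventually_at_right_field by blast

  \<comment> \<open>Using the same \<open>h\<close> on both sides makes the slope of the chord the
    mean of the slopes of its two halves, hence close to \<open>c\<close>. Halving keeps
    \<open>p\<close> and \<open>q\<close> strictly between \<open>b1\<close> and
    \<open>b2\<close>.\<close>
  define h where "h = min (\<tau> - b1) (b2 - \<tau>) / 2"
  define p where "p = \<tau> - h"
  define q where "q = \<tau> + h"
  have h: "h > 0" "b1 < p" "q < b2"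
    using b1 b2 by (auto simp: h_def p_def q_def min_def field_simps)
  then have pq: "p < \<tau>" "\<tau> < q" "\<tau> - p = h" "q - \<tau> = h"
    by (auto simp: p_def q_def)
  have apqb: "a < p" "q < b"
    using left[of p] right[of q] h pq by auto
  have xpq: "x p \<in> ball (x \<tau>) \<rho>" "x q \<in> ball (x \<tau>) \<rho>"
    using left[of p] right[of q] h pq by auto
  have slope_pq: "slope x p q \<in> ball c \<rho>"
  proof -
    have "slope x p q = (slope x p \<tau> + slope x \<tau> q) / 2"
      using h(1) by (simp add: slope_def p_def q_def field_simps)
    then have "c - slope x p q = ((lderiv \<tau> - slope x p \<tau>) + (rderiv \<tau> - slope x \<tau> q)) / 2"
      by (simp add: c_def field_simps)
    moreover have "\<bar>slope x p \<tau> - lderiv \<tau>\<bar> < \<rho>" "\<bar>slope x \<tau> q - rderiv \<tau>\<bar> < \<rho>"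
      using left[of p] right[of q] h pq by auto
    ultimately show ?thesis
      by (auto simp: dist_real_def abs_less_iff)
  qed
  have cut_cost: "f (t, cut p q t, deriv (cut p q) t) < \<phi> c + \<eta>" if t: "t \<in> {p<..<q}" for t
  proof -
    obtain u where u: "u \<in> {0..1}" "cut p q t = (1 - u) * x p + u * x q"
      using cut_convex_combination[of p q t] t by auto
    have "(1 - u) *\<^sub>R x p + u *\<^sub>R x q \<in> ball (x \<tau>) \<rho>"
      using u(1) xpq by (intro convexD_alt convex_ball) auto
    moreover have "t \<in> ball \<tau> \<rho>"
      using left[of p] right[of q] h pq t by (auto simp: dist_real_def)
    ultimately show ?thesis
      using near[OF _ _ slope_pq] u(2) deriv_cut_inside[OF t] by simp
  qed

  \<comment> \<open>The cut function is again convex and continuous, so the bounds and the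
    integrability proved for \<open>x\<close> apply to it as well.\<close>
  interpret cut: convex_interval a b "cut p q"
    using ab convex_on_cut[of p q] continuous_on_cut[of p q] apqb pq by unfold_locales auto
  obtain K1 where "\<And>t. t \<in> {a<..<b} \<Longrightarrow> \<bar>rderiv t\<bar> \<le> K1"
    using rderiv_bounded_if_deriv_limits[OF lim] by blast
  note int_x = integrable_along_deriv[OF contf this]
  obtain K2 where "\<And>t. t \<in> {a<..<b} \<Longrightarrow> \<bar>cut.rderiv t\<bar> \<le> K2"
    using cut.rderiv_bounded_if_deriv_limits[OF deriv_limit_cut(1)[OF apqb lim(1)] deriv_limit_cut(2)[OF apqb lim(2)]]
    by blast
  note int_cut = cut.integrable_along_deriv[OF contf this]
  \<comment> \<open>Only the corners of \<open>x\<close> are collected: possible kinks of the cut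
    function are at \<open>p\<close> and \<open>q\<close>, which are ends of the pieces of
    integration below.\<close>
  define N where "N = {t \<in> {a<..<b}. \<not> x differentiable (at t)}"
  have N: "countable N"
    unfolding N_def by (rule countable_nondifferentiable)
  define D where "D t = f (t, x t, deriv x t) - f (t, cut p q t, deriv (cut p q) t)" for t
  have int_D: "D integrable_on {s..t}" if "a \<le> s" "t \<le> b" for s t
  proof (rule integrable_on_subinterval)
    show "D integrable_on {a..b}"
      unfolding D_def by (intro integrable_diff int_x int_cut)
  qed (use that in auto)
  have "0 * (p - a) \<le> integral {a..p} D"
  proof (rule integral_ge_if_ge_off_countable[OF _ _ N])
    fix t assume "t \<in> {a<..<p} - N"
    then have "deriv (cut p q) t = deriv x t"
      by (intro differentiable_deriv_local[of "{..<p}"]) (auto simp: cut_def)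
    then show "0 \<le> D t"
      using \<open>t \<in> {a<..<p} - N\<close> by (simp add: D_def cut_def)
  qed (use apqb pq int_D in auto)
  moreover have "0 * (b - q) \<le> integral {q..b} D"
  proof (rule integral_ge_if_ge_off_countable[OF _ _ N])
    fix t assume "t \<in> {q<..<b} - N"
    then have "deriv (cut p q) t = deriv x t"
      by (intro differentiable_deriv_local[of "{q<..}"]) (auto simp: cut_def)
    then show "0 \<le> D t"
      using \<open>t \<in> {q<..<b} - N\<close> by (simp add: D_def cut_def)
  qed (use apqb pq int_D in auto)
  moreover have "(\<phi> (lderiv \<tau>) - \<phi> c - 2 * \<eta>) * (\<tau> - p) \<le> integral {p..\<tau>} D"
  proof (rule integral_ge_if_ge_off_countable[OF _ _ N])
    fix t assume t: "t \<in> {p<..<\<tau>} - N"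
    then have "\<phi> (lderiv \<tau>) - \<eta> < f (t, x t, deriv x t)"
      using left[of t] deriv_eq_rderiv[of t] h pq apqb by (auto simp: N_def)
    then show "\<phi> (lderiv \<tau>) - \<phi> c - 2 * \<eta> \<le> D t"
      using cut_cost[of t] t pq by (simp add: D_def)
  qed (use apqb pq int_D in auto)
  moreover have "(\<phi> (rderiv \<tau>) - \<phi> c - 2 * \<eta>) * (q - \<tau>) \<le> integral {\<tau>..q} D"
  proof (rule integral_ge_if_ge_off_countable[OF _ _ N])
    fix t assume t: "t \<in> {\<tau><..<q} - N"
    then have "\<phi> (rderiv \<tau>) - \<eta> < f (t, x t, deriv x t)"
      using right[of t] deriv_eq_rderiv[of t] h pq apqb by (auto simp: N_def)
    then show "\<phi> (rderiv \<tau>) - \<phi> c - 2 * \<eta> \<le> D t"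
      using cut_cost[of t] t pq by (simp add: D_def)
  qed (use apqb pq int_D in auto)
  moreover have "integral {a..b} D = integral {a..p} D + integral {p..\<tau>} D + integral {\<tau>..q} D + integral {q..b} D"
    using Henstock_Kurzweil_Integration.integral_combine[of a p b D]
      Henstock_Kurzweil_Integration.integral_combine[of p \<tau> b D]
      Henstock_Kurzweil_Integration.integral_combine[of \<tau> q b D] int_D apqb pq
    by simp
  moreover have "(\<phi> (lderiv \<tau>) - \<phi> c - 2 * \<eta>) * h + (\<phi> (rderiv \<tau>) - \<phi> c - 2 * \<eta>) * h = 4 * \<eta> * h"
    by (simp add: \<eta>_def algebra_simps)
  moreover have "4 * \<eta> * h > 0"
    using \<eta> h by simp
  ultimately have "0 < integral {a..b} D"
    using pq by simp
  moreover have "integral {a..b} D = cost f a b x - cost f a b (cut p q)"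
    unfolding D_def cost_def by (rule integral_diff[OF int_x int_cut])
  ultimately show thesis
    using apqb pq by (intro that[of p q]) auto
qed

section \<open>Subgradients at a corner, and regularity in the absence of corners\<close>

lemma subdifferential_between_slopes:
  assumes \<tau>: "\<tau> \<in> {a<..<b}" and v: "v \<in> {lderiv \<tau>..rderiv \<tau>}"
  shows "v \<in> subdifferential_on {a..b} x \<tau>"
  unfolding subdifferential_on_def
proof clarify
  fix s assume s: "s \<in> {a..b}"
  consider "s < \<tau>" | "s = \<tau>" | "\<tau> < s"
    by linarith
  then show "x \<tau> + v * (s - \<tau>) \<le> x s"
  proof cases
    case 1
    then have "slope x s \<tau> \<le> v"
      using slope_le_lderiv[of s \<tau>] \<tau> v s by auto
    with 1 show ?thesis
      by (simp add: slope_def field_simps)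
  next
    case 3
    then have "v \<le> slope x \<tau> s"
      using rderiv_le_slope[of a \<tau> s] \<tau> v s by auto
    with 3 show ?thesis
      by (simp add: slope_def field_simps)
  qed simp
qed

text \<open>Inside, the derivative \<open>rderiv\<close> is continuous because its left limit
  \<open>lderiv\<close> equals its value. The limits \<open>l\<close> and \<open>m\<close> extend it
  continuously to the endpoints, and representing \<open>x\<close> as an integral of this extension
  gives the one-sided derivatives there.\<close>

lemma C1_if_no_corners:
  assumes no_corner: "\<And>t. t \<in> {a<..<b} \<Longrightarrow> lderiv t = rderiv t"
    and lim: "deriv_limit a b x a l" "deriv_limit a b x b m"
  shows "C1_on_interval a b x"
proof -
  define x' where "x' t = (if t \<le> a then l else if b \<le> t then m else rderiv t)" for t
  have der: "(x has_real_derivative rderiv t) (at t)" if "t \<in> {a<..<b}" for t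
    using has_derivative_if_no_corner no_corner that by blast
  \<comment> \<open>Without corners the restricted limits in \<open>deriv_limit\<close> become
    limits along the whole open interval.\<close>
  have D: "differentiability_points a b x = {a<..<b}"
    using der unfolding differentiability_points_def real_differentiable_def by blast
  have deriv: "eventually (\<lambda>t. deriv x t = x' t) (at c within {a<..<b})" for c
    unfolding eventually_at_filter using der[THEN DERIV_imp_deriv] by (simp add: x'_def)
  have x'_tendsto: "(x' \<longlongrightarrow> x' c) (at c within {a<..<b})" if "c \<in> {a, b}" for c
    using lim that ab unfolding deriv_limit_def D tendsto_cong[OF deriv] by (auto simp: x'_def)
  have "(x' \<longlongrightarrow> x' c) (at c within {a..b})" if c: "c \<in> {a..b}" for c
  proof -
    consider "c = a" | "c = b" | "c \<in> {a<..<b}"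
      using c by fastforce
    then show ?thesis
    proof cases
      case 1
      have "at c within {a..b} = at c within {a<..<b}"
        using ab 1 by (intro at_within_nhd[of c "{..<b}"]) auto
      then show ?thesis
        using x'_tendsto 1 by simp
    next
      case 2
      have "at c within {a..b} = at c within {a<..<b}"
        using ab 2 by (intro at_within_nhd[of c "{a<..}"]) auto
      then show ?thesis
        using x'_tendsto 2 by simp
    next
      case 3
      have "(rderiv \<longlongrightarrow> rderiv c) (at c)"
        using rderiv_tendsto_left[OF 3] rderiv_tendsto_right[OF 3] no_corner[OF 3] by (simp add: filterlim_split_at)
      moreover have "eventually (\<lambda>t. rderiv t = x' t) (at c)"
        using eventually_at_in_open[of "{a<..<b}" c] 3 by (auto elim!: eventually_mono simp: x'_def)
      ultimately have "(x' \<longlongrightarrow> x' c) (at c)"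
        using 3 tendsto_cong by (fastforce simp: x'_def)
      then show ?thesis
        using tendsto_within_subset by blast
    qed
  qed
  then have cont': "continuous_on {a..b} x'"
    by (simp add: continuous_on)
  \<comment> \<open>This form of the fundamental theorem asks for derivatives only in the interior
    and for continuity of \<open>x\<close> up to the ends, so nothing about the endpoint derivatives
    is presupposed.\<close>
  have x_eq: "x a + integral {a..t} x' = x t" if t: "t \<in> {a..b}" for t
  proof -
    have "(x' has_integral x t - x a) {a..t}"
      using t der
      by (intro fundamental_theorem_of_calculus_interior continuous_on_subset[OF cont])
        (auto simp: x'_def has_real_derivative_iff_has_vector_derivative[symmetric])
    then show ?thesis
      by (simp add: integral_unique)
  qed
  have "(x has_real_derivative x' t) (at t within {a..b})" if t: "t \<in> {a..b}" for t
  proof (rule has_field_derivative_transform_within[OF _ zero_less_one t x_eq])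
    show "((\<lambda>t. x a + integral {a..t} x') has_real_derivative x' t) (at t within {a..b})"
      using DERIV_add[OF DERIV_const integral_has_real_derivative[OF cont' t]] by simp
  qed
  with cont' show ?thesis
    unfolding C1_on_interval_def by blast
qed

end

theorem theorem4:
  fixes U :: "(real \<times> real) set"
    and t0 t1 s0 s1 x0 x1 :: real
    and f :: "real \<times> real \<times> real \<Rightarrow> real"
    and xh :: "real \<Rightarrow> real"
  assumes "convex U" and "interior U \<noteq> {}"
    and "t0 < t1" and "s0 < s1"
    and "C2_function f"
    and "optimal f U t0 t1 s0 s1 x0 x1 xh"
    and "\<And>t. t \<in> {t0<..<t1} \<Longrightarrow> (t, xh t) \<in> interior U"
    and "\<And>p. p \<in> Gamma_set t0 t1 xh \<Longrightarrow> second_partial_velocity f p > 0"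
  shows "C1_on_interval t0 t1 xh"
proof -
  have adm: "xh \<in> admissible U t0 t1 s0 s1 x0 x1"
    and min: "\<And>y. y \<in> admissible U t0 t1 s0 s1 x0 x1 \<Longrightarrow> cost f t0 t1 xh \<le> cost f t0 t1 y"
    using assms(6) by (auto simp: optimal_def)
  interpret convex_interval t0 t1 xh
    using adm assms(3) by unfold_locales (auto simp: admissible_def)
  obtain l m where lim: "deriv_limit t0 t1 xh t0 l" "deriv_limit t0 t1 xh t1 m"
    using adm by (auto simp: admissible_def)
  show ?thesis
  proof (rule C1_if_no_corners[OF _ lim])
    fix t assume t: "t \<in> {t0<..<t1}"
    show "lderiv t = rderiv t"
    proof (rule ccontr)
      assume "lderiv t \<noteq> rderiv t"
      then have "lderiv t < rderiv t"
        using lderiv_le_rderiv[OF t] by simp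
      \<comment> \<open>Every velocity between the one-sided derivatives is a subgradient, so the
        point lies in \<open>Gamma_set\<close>.\<close>
      moreover have "second_partial_velocity f (t, xh t, v) > 0" if "v \<in> {lderiv t..rderiv t}" for v
        using assms(8) subdifferential_between_slopes[OF t that] t by (simp add: Gamma_set_def)
      ultimately obtain p q where pq: "t0 < p" "p < q" "q < t1" "cost f t0 t1 (cut p q) < cost f t0 t1 xh"
        using corner_not_optimal[OF assms(5) lim t] by blast
      then show False
        using min[OF cut_admissible[OF adm assms(1)]] by fastforce
    qed
  qed
qed

end
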